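(* Let $X$ and $Y$ have finite alphabets $\mathcal X$ and $\mathcal Y$ and joint pmf $p_{X,Y}(x,y)$. To compute $G(X;Y)$ it suffices to consider $W$ with cardinality $|\mathcal W|\le 2^{\min(|\mathcal X|,|\mathcal Y|)}-1$; that is, the minimum of $H(W)$ over all discrete $W$ with $X\to W\to Y$ equals the minimum over those $W$ whose alphabet $\mathcal W$ satisfies in addition $|\mathcal W|\le 2^{\min(|\mathcal X|,|\mathcal Y|)}-1$.
   Context: $H$ denotes Shannon entropy. $X\to W\to Y$ means that $X$ and $Y$ are conditionally independent given $W$, where $W$ is a discrete random variable jointly distributed with $(X,Y)$ and the joint pmf of $(X,Y)$ is fixed. The common entropy is $G(X;Y)=\min_{W:\,X\to W\to Y}H(W)$. *)

theory Defs
  imports "HOL-Probability.Probability"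
begin

(* Entropy in bits, as an extended nonnegative real: a discrete random variable may have
   infinite entropy, for which the real-valued entropy of HOL-Probability.Information, being
   a Bochner integral, would return 0. Each term is nonnegative, and 0 * log 2 0 = 0. *)
definition shannon_entropy :: "'w pmf \<Rightarrow> ennreal" where
  "shannon_entropy r = (\<integral>\<^sup>+ w. ennreal (- (pmf r w * log 2 (pmf r w))) \<partial>count_space UNIV)"

(* A pmf q on ('a * 'b) * 'w is the joint law of ((X, Y), W). *)
definition cond_indep :: "(('a \<times> 'b) \<times> 'w) pmf \<Rightarrow> bool" where
  "cond_indep q \<longleftrightarrow> (\<forall>w \<in> set_pmf (map_pmf snd q). \<forall>x y.
     \<P>(\<omega> in measure_pmf q. fst (fst \<omega>) = x \<and> snd (fst \<omega>) = y \<bar> snd \<omega> = w) =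
     \<P>(\<omega> in measure_pmf q. fst (fst \<omega>) = x \<bar> snd \<omega> = w) *
     \<P>(\<omega> in measure_pmf q. snd (fst \<omega>) = y \<bar> snd \<omega> = w))"

(* The joint laws of ((X, Y), W) with (X, Y) distributed as p, W taking values in the
   alphabet \<W>, and X \<rightarrow> W \<rightarrow> Y. *)
definition markov_couplings :: "('a \<times> 'b) pmf \<Rightarrow> 'w set \<Rightarrow> (('a \<times> 'b) \<times> 'w) pmf set" where
  "markov_couplings p \<W> =
     {q. map_pmf fst q = p \<and> set_pmf (map_pmf snd q) \<subseteq> \<W> \<and> cond_indep q}"

(* The values H(W) over all discrete W with X \<rightarrow> W \<rightarrow> Y. Letting W take values in nat is no
   restriction, by markov_couplings_relabel below. *)
definition markov_entropies :: "('a \<times> 'b) pmf \<Rightarrow> ennreal set" where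
  "markov_entropies p =
     {shannon_entropy (map_pmf snd q) | q. q \<in> markov_couplings p (UNIV :: nat set)}"

definition markov_entropies_card :: "('a \<times> 'b) pmf \<Rightarrow> nat \<Rightarrow> ennreal set" where
  "markov_entropies_card p n =
     {shannon_entropy (map_pmf snd q) | q (\<W> :: nat set).
        finite \<W> \<and> card \<W> \<le> n \<and> q \<in> markov_couplings p \<W>}"

(* Infimum; it is a minimum exactly when it belongs to markov_entropies p. *)
definition common_entropy :: "('a \<times> 'b) pmf \<Rightarrow> ennreal" where
  "common_entropy p = Inf (markov_entropies p)"

lemma shannon_entropy_map_inj:
  assumes "inj_on f (set_pmf r)"
  shows "shannon_entropy (map_pmf f r) = shannon_entropy r"
proof -
  let ?g = "\<lambda>t. ennreal (- (t * log 2 t))"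
  have restrict: "shannon_entropy s = (\<integral>\<^sup>+ w. ?g (pmf s w) \<partial>count_space (set_pmf s))"
    for s :: "'c pmf"
    unfolding shannon_entropy_def
    by (rule nn_integral_count_space_eq) (auto simp: set_pmf_iff)
  have "bij_betw f (set_pmf r) (set_pmf (map_pmf f r))"
    using assms by (simp add: bij_betw_def)
  then have "(\<integral>\<^sup>+ w. ?g (pmf (map_pmf f r) w) \<partial>count_space (set_pmf (map_pmf f r))) =
      (\<integral>\<^sup>+ w. ?g (pmf (map_pmf f r) (f w)) \<partial>count_space (set_pmf r))"
    by (rule nn_integral_bij_count_space[symmetric])
  also have "\<dots> = (\<integral>\<^sup>+ w. ?g (pmf r w) \<partial>count_space (set_pmf r))"
    by (rule nn_integral_cong) (simp add: pmf_map_inj[OF assms])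
  finally show ?thesis
    by (simp only: restrict)
qed

lemma markov_couplings_relabel:
  fixes q :: "(('a \<times> 'b) \<times> 'w) pmf"
  assumes q: "q \<in> markov_couplings p UNIV"
  obtains q' :: "(('a \<times> 'b) \<times> nat) pmf" where
    "q' \<in> markov_couplings p UNIV"
    "shannon_entropy (map_pmf snd q') = shannon_entropy (map_pmf snd q)"
proof
  let ?S = "set_pmf (map_pmf snd q)"
  let ?f = "to_nat_on ?S"
  let ?q' = "map_pmf (map_prod id ?f) q"
  have inj: "inj_on ?f ?S"
    by (rule inj_on_to_nat_on) (rule countable_set_pmf)
  have snd': "map_pmf snd ?q' = map_pmf ?f (map_pmf snd q)"
    by (simp add: pmf.map_comp comp_def)
  have fst': "map_pmf fst ?q' = map_pmf fst q"
    by (simp add: pmf.map_comp comp_def)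
  show "shannon_entropy (map_pmf snd ?q') = shannon_entropy (map_pmf snd q)"
    unfolding snd' by (rule shannon_entropy_map_inj[OF inj])
  have eq: "\<P>(\<omega> in measure_pmf ?q'. P (fst \<omega>) \<and> snd \<omega> = ?f w) =
      \<P>(\<omega> in measure_pmf q. P (fst \<omega>) \<and> snd \<omega> = w)" if w: "w \<in> ?S" for P w
  proof -
    have "?f (snd z) = ?f w \<longleftrightarrow> snd z = w" if "z \<in> set_pmf q" for z
      using inj w that by (auto simp: inj_on_eq_iff)
    then show ?thesis
      by (auto simp: vimage_def intro!: measure_pmf.finite_measure_eq_AE simp: AE_measure_pmf_iff)
  qed
  have eq1: "\<P>(\<omega> in measure_pmf ?q'. snd \<omega> = ?f w) = \<P>(\<omega> in measure_pmf q. snd \<omega> = w)"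
    if "w \<in> ?S" for w
    using eq[OF that, of "\<lambda>_. True"] by simp
  have cond: "\<P>(\<omega> in measure_pmf ?q'. P (fst \<omega>) \<bar> snd \<omega> = ?f w) =
      \<P>(\<omega> in measure_pmf q. P (fst \<omega>) \<bar> snd \<omega> = w)" if "w \<in> ?S" for P w
    unfolding cond_prob_def eq[OF that] eq1[OF that] ..
  have "cond_indep ?q'"
    unfolding cond_indep_def snd'
  proof (intro ballI allI)
    fix v x y
    assume "v \<in> set_pmf (map_pmf ?f (map_pmf snd q))"
    then obtain w where w: "w \<in> ?S" and v: "v = ?f w"
      by auto
    show "\<P>(\<omega> in measure_pmf ?q'. fst (fst \<omega>) = x \<and> snd (fst \<omega>) = y \<bar> snd \<omega> = v) =
      \<P>(\<omega> in measure_pmf ?q'. fst (fst \<omega>) = x \<bar> snd \<omega> = v) *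
      \<P>(\<omega> in measure_pmf ?q'. snd (fst \<omega>) = y \<bar> snd \<omega> = v)"
      unfolding v
        cond[OF w, of "\<lambda>u. fst u = x \<and> snd u = y"] cond[OF w, of "\<lambda>u. fst u = x"]
        cond[OF w, of "\<lambda>u. snd u = y"]
      using q w by (auto simp: markov_couplings_def cond_indep_def)
  qed
  then show "?q' \<in> markov_couplings p UNIV"
    using q fst' by (simp add: markov_couplings_def)
qed

end

theory Submission
  imports Defs "HOL-Real_Asymp.Real_Asymp"
begin

(* If two symbols v, w of W have P(X = x, W = v) and P(X = x, W = w) with the same support in x,
   mass can be moved from the lighter to the heavier one without changing the law of (X, Y) or the
   Markov property, until the lighter one loses a point of its support. This makes P_W more uneven
   and so does not increase H(W). Clearing the supports from the largest to the smallest leaves at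
   most one symbol per nonempty subset of the alphabet of X, that is 2^|X| - 1 symbols; exchanging
   the roles of X and Y gives the minimum in the exponent. For W on a fixed finite alphabet the set
   of couplings is compact and H is continuous, so the minimum is attained. *)

section \<open>The entropy term: concavity and continuity\<close>

definition plog :: "real \<Rightarrow> real" where
  "plog t = - (t * log 2 t)"

lemma plog_nonneg:
  assumes "0 \<le> t" and "t \<le> 1"
  shows "0 \<le> plog t"
  using assms by (cases "t = 0") (auto simp: plog_def mult_le_0_iff)

text \<open>Concavity puts the graph below its tangent at \<open>t\<close>. For positive
  \<open>s\<close> this is \<open>ln r <= r - 1\<close> at \<open>r = t / s\<close>, multiplied by
  \<open>s\<close> and divided by \<open>ln 2\<close>.\<close>

lemma plog_tangent:
  assumes "0 \<le> s" and "0 < t"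
  shows "plog s \<le> plog t + (s - t) * (- (ln t + 1) / ln 2)"
proof (cases "s = 0")
  case True
  then show ?thesis
    using assms by (simp add: plog_def log_def field_simps)
next
  case False
  then have s: "0 < s" using assms by simp
  have "ln (t / s) \<le> t / s - 1"
    using s assms by (intro ln_le_minus_one) simp
  then have "s * (ln t - ln s) \<le> t - s"
    using s assms by (simp add: ln_div field_simps)
  then have "- (s * ln s) \<le> - (t * ln t) + (s - t) * (- (ln t + 1))"
    by (simp add: algebra_simps)
  then have "- (s * ln s) / ln 2 \<le> (- (t * ln t) + (s - t) * (- (ln t + 1))) / ln 2"
    by (intro divide_right_mono) auto
  then show ?thesis
    by (simp add: plog_def log_def add_divide_distrib diff_divide_distrib algebra_simps)
qed

text \<open>The slope of \<open>plog\<close> is decreasing, so its value at \<open>t\<close> is at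
  least its value at \<open>M\<close>. Stating the saving with the slope at \<open>M\<close> lets
  all lighter symbols share one constant.\<close>

lemma plog_move_mass:
  assumes "0 \<le> d" "d \<le> t" "0 < t" "t \<le> M"
  shows "plog (t - d) \<le> plog t - d * (- (ln M + 1) / ln 2)"
proof -
  have "plog (t - d) \<le> plog t + (t - d - t) * (- (ln t + 1) / ln 2)"
    using assms by (intro plog_tangent) auto
  also have "\<dots> = plog t + d * ((ln t + 1) / ln 2)"
    by (simp add: field_simps)
  also have "\<dots> \<le> plog t + d * ((ln M + 1) / ln 2)"
    using assms by (intro add_left_mono mult_left_mono divide_right_mono) auto
  also have "\<dots> = plog t - d * (- (ln M + 1) / ln 2)"
    by (simp add: field_simps)
  finally show ?thesis .
qed

text \<open>The point 0 has to be included, since the mass of a symbol may vanish in a limit of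
  couplings. There \<open>t * ln t\<close> tends to 0, which agrees with
  \<open>plog 0 = 0\<close>.\<close>

lemma continuous_on_plog: "continuous_on {0..} plog"
proof -
  have "(plog \<longlongrightarrow> plog t) (at t within {0..})" if "0 \<le> t" for t
  proof (cases "t = 0")
    case True
    have "((\<lambda>t. - (t * (ln t / ln 2))) \<longlongrightarrow> 0) (at_right (0::real))"
      by real_asymp
    moreover have "at t within {0..} = at_right (0::real)"
      unfolding True by (rule at_within_Ici_at_right)
    ultimately show ?thesis
      using True by (simp add: plog_def[abs_def] log_def)
  next
    case False
    then have "((\<lambda>t. - (t * log 2 t)) \<longlongrightarrow> - (t * log 2 t)) (at t within {0..})"
      using that by (intro tendsto_intros) auto
    then show ?thesis
      by (simp add: plog_def[abs_def])
  qed
  then show ?thesis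
    by (auto simp: continuous_on_def)
qed

section \<open>Marginals and the Markov condition in terms of point masses\<close>

lemma pmf_map_eq_sum:
  assumes "finite I" and inj: "inj_on g I" and "\<And>i. i \<in> I \<Longrightarrow> f (g i) = v"
    and "\<And>z. z \<in> set_pmf q \<Longrightarrow> f z = v \<Longrightarrow> z \<in> g ` I"
  shows "pmf (map_pmf f q) v = (\<Sum>i\<in>I. pmf q (g i))"
proof -
  have "pmf (map_pmf f q) v = measure q (f -` {v})"
    by (simp add: pmf_map)
  also have "\<dots> = measure q (g ` I)"
    using assms by (intro measure_pmf.finite_measure_eq_AE) (auto simp: AE_measure_pmf_iff)
  also have "\<dots> = sum (pmf q) (g ` I)"
    using assms by (simp add: measure_measure_pmf_finite)
  finally show ?thesis
    by (simp add: sum.reindex[OF inj])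
qed

lemma pmf_map_fst_sums:
  fixes q :: "('z \<times> nat) pmf"
  shows "(\<lambda>w. pmf q (z, w)) sums pmf (map_pmf fst q) z"
proof -
  have "(\<lambda>w. measure q {(z, w)}) sums measure q (\<Union>w. {(z, w)})"
    by (rule measure_pmf.finite_measure_UNION) (auto simp: disjoint_family_on_def)
  moreover have "(\<Union>w::nat. {(z, w)}) = fst -` {z}"
    by auto
  ultimately show ?thesis
    by (simp only: pmf_map measure_pmf_single)
qed

abbreviation XW :: "(('a \<times> 'b) \<times> 'w) \<Rightarrow> 'a \<times> 'w" where
  "XW z \<equiv> (fst (fst z), snd z)"

abbreviation YW :: "(('a \<times> 'b) \<times> 'w) \<Rightarrow> 'b \<times> 'w" where
  "YW z \<equiv> (snd (fst z), snd z)"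

lemma
  assumes fin: "finite X" "finite Y" and supp: "set_pmf (map_pmf fst q) \<subseteq> X \<times> Y"
  shows pmf_snd_eq_sum: "pmf (map_pmf snd q) w = (\<Sum>x\<in>X. \<Sum>y\<in>Y. pmf q ((x, y), w))"
    and pmf_XW_eq_sum: "pmf (map_pmf XW q) (x, w) = (\<Sum>y\<in>Y. pmf q ((x, y), w))"
    and pmf_YW_eq_sum: "pmf (map_pmf YW q) (y, w) = (\<Sum>x\<in>X. pmf q ((x, y), w))"
proof -
  have set_q: "x \<in> X \<and> y \<in> Y" if "((x, y), w) \<in> set_pmf q" for x y w
    using that supp by force
  have "pmf (map_pmf snd q) w = (\<Sum>z\<in>X \<times> Y. pmf q (z, w))"
    using fin set_q by (intro pmf_map_eq_sum) (auto intro!: inj_onI)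
  then show "pmf (map_pmf snd q) w = (\<Sum>x\<in>X. \<Sum>y\<in>Y. pmf q ((x, y), w))"
    by (simp add: sum.cartesian_product split_def)
  show "pmf (map_pmf XW q) (x, w) = (\<Sum>y\<in>Y. pmf q ((x, y), w))"
    using fin set_q by (intro pmf_map_eq_sum) (auto intro!: inj_onI)
  show "pmf (map_pmf YW q) (y, w) = (\<Sum>x\<in>X. pmf q ((x, y), w))"
    using fin set_q by (intro pmf_map_eq_sum) (auto intro!: inj_onI)
qed

text \<open>On the support of \<open>W\<close> the denominator P(W = w) is nonzero, so multiplying
  by its square gives an equivalent condition free of division.\<close>

lemma cond_indep_iff:
  "cond_indep q \<longleftrightarrow> (\<forall>w \<in> set_pmf (map_pmf snd q). \<forall>x y.
     pmf q ((x, y), w) * pmf (map_pmf snd q) w =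
     pmf (map_pmf XW q) (x, w) * pmf (map_pmf YW q) (y, w))"
proof -
  have "measure q {\<omega> \<in> space q. (fst (fst \<omega>) = x \<and> snd (fst \<omega>) = y) \<and> snd \<omega> = w} = pmf q ((x, y), w)"
      for x y w
    by (subst measure_pmf_single[symmetric]) (rule arg_cong[of _ _ "measure q"], auto)
  moreover have "measure q {\<omega> \<in> space q. fst (fst \<omega>) = x \<and> snd \<omega> = w} = pmf (map_pmf XW q) (x, w)"
      for x w
    by (auto simp: pmf_map vimage_def)
  moreover have "measure q {\<omega> \<in> space q. snd (fst \<omega>) = y \<and> snd \<omega> = w} = pmf (map_pmf YW q) (y, w)"
      for y w
    by (auto simp: pmf_map vimage_def)
  moreover have "measure q {\<omega> \<in> space q. snd \<omega> = w} = pmf (map_pmf snd q) w" for w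
    by (auto simp: pmf_map vimage_def)
  moreover have "a / m = b / m * (c / m) \<longleftrightarrow> a * m = b * c" if "m \<noteq> 0" for a b c m :: real
    using that by (simp add: field_simps)
  ultimately show ?thesis
    unfolding cond_indep_def cond_prob_def by (simp add: set_pmf_iff del: set_map_pmf)
qed

section \<open>Couplings as sums of rank-one terms\<close>

text \<open>A coupling is encoded by \<open>a w x = P(X = x, W = w)\<close> and \<open>u w y = P(Y = y | W = w)\<close>. Where
  \<open>W = w\<close> has probability \<open>0\<close>, \<open>u w\<close> may be any probability vector on \<open>Y\<close>.\<close>

definition factorization ::
    "('a \<times> 'b) pmf \<Rightarrow> 'a set \<Rightarrow> 'b set \<Rightarrow> (nat \<Rightarrow> 'a \<Rightarrow> real) \<Rightarrow> (nat \<Rightarrow> 'b \<Rightarrow> real) \<Rightarrow> bool" where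
  "factorization p X Y a u \<longleftrightarrow>
     (\<forall>w x. 0 \<le> a w x) \<and> (\<forall>w x. x \<notin> X \<longrightarrow> a w x = 0) \<and>
     (\<forall>w y. 0 \<le> u w y) \<and> (\<forall>w y. y \<notin> Y \<longrightarrow> u w y = 0) \<and> (\<forall>w. sum (u w) Y = 1) \<and>
     (\<forall>x y. (\<lambda>w. a w x * u w y) sums pmf p (x, y))"

text \<open>Because \<open>u w\<close> has total 1, \<open>sum (a w) X\<close> is P(W = w). The
  series is formed in \<open>ennreal\<close>, so that infinite entropy is covered.\<close>

definition fact_entropy :: "'a set \<Rightarrow> (nat \<Rightarrow> 'a \<Rightarrow> real) \<Rightarrow> ennreal" where
  "fact_entropy X a = (\<Sum>w. ennreal (plog (sum (a w) X)))"

lemma factorizationI: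
  assumes "\<And>w x. 0 \<le> a w x" and "\<And>w x. x \<notin> X \<Longrightarrow> a w x = 0"
    and "\<And>w y. 0 \<le> u w y" and "\<And>w y. y \<notin> Y \<Longrightarrow> u w y = 0" and "\<And>w. sum (u w) Y = 1"
    and "\<And>x y. (\<lambda>w. a w x * u w y) sums pmf p (x, y)"
  shows "factorization p X Y a u"
  using assms by (simp add: factorization_def)

lemma factorizationD:
  assumes "factorization p X Y a u"
  shows "0 \<le> a w x" and "x \<notin> X \<Longrightarrow> a w x = 0"
    and "0 \<le> u w y" and "y \<notin> Y \<Longrightarrow> u w y = 0" and "sum (u w) Y = 1"
    and "(\<lambda>w. a w x * u w y) sums pmf p (x, y)"
  using assms by (simp_all add: factorization_def)

lemma shannon_entropy_nat:
  fixes r :: "nat pmf"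
  assumes "\<And>w. pmf r w = sum (a w) X"
  shows "shannon_entropy r = fact_entropy X a"
  unfolding shannon_entropy_def fact_entropy_def nn_integral_count_space_nat assms plog_def ..

text \<open>Here \<open>a\<close> is the joint law of X and W, and \<open>u\<close> is the
  conditional law of Y given W; the Markov property says exactly that their product is the joint
  pmf.\<close>

lemma factorization_of_coupling:
  assumes fin: "finite X" "finite Y" and supp: "set_pmf p \<subseteq> X \<times> Y"
    and q: "q \<in> markov_couplings p (UNIV :: nat set)"
  obtains a u where "factorization p X Y a u"
    and "shannon_entropy (map_pmf snd q) = fact_entropy X a"
proof
  have p: "map_pmf fst q = p" and ci: "cond_indep q"
    using q by (auto simp: markov_couplings_def)
  define m where "m w = pmf (map_pmf snd q) w" for w
  define a where "a w x = pmf (map_pmf XW q) (x, w)" for w x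
  define b where "b w y = pmf (map_pmf YW q) (y, w)" for w y
  define y0 where "y0 = (SOME y. y \<in> Y)"
  have "Y \<noteq> {}"
    using supp set_pmf_not_empty[of p] by fast
  then have y0: "y0 \<in> Y"
    unfolding y0_def by (rule some_in_eq[THEN iffD2])
  \<comment> \<open>On symbols of mass 0 the quotient \<open>b w y / m w\<close> would have total 0;
    the point mass at \<open>y0\<close> keeps \<open>u w\<close> a probability vector.\<close>
  define u where "u w y = (if m w = 0 then if y = y0 then 1 else 0 else b w y / m w)" for w y
  have set_q: "set_pmf (map_pmf fst q) \<subseteq> X \<times> Y"
    using supp p by simp
  have a_sum: "a w x = (\<Sum>y\<in>Y. pmf q ((x, y), w))" for w x
    unfolding a_def by (rule pmf_XW_eq_sum[OF fin set_q])
  have b_sum: "b w y = (\<Sum>x\<in>X. pmf q ((x, y), w))" for w y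
    unfolding b_def by (rule pmf_YW_eq_sum[OF fin set_q])
  have m_a: "m w = sum (a w) X" for w
    unfolding m_def a_sum by (rule pmf_snd_eq_sum[OF fin set_q])
  have m_b: "m w = sum (b w) Y" for w
    unfolding m_a a_sum b_sum by (rule sum.swap)
  have q0: "pmf q ((x, y), w) = 0" if "x \<notin> X \<or> y \<notin> Y" for x y w
    using that set_q by (force simp: set_pmf_iff)
  have a0: "a w x = 0" if "x \<notin> X" for w x
    using that by (simp add: a_sum q0)
  have b0: "b w y = 0" if "y \<notin> Y" for w y
    using that by (simp add: b_sum q0)
  have prod: "a w x * u w y = pmf q ((x, y), w)" for w x y
  proof (cases "m w = 0")
    case True
    then have "w \<notin> set_pmf (map_pmf snd q)"
      by (simp only: m_def set_pmf_iff not_not)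
    then have "pmf q ((x, y), w) = 0"
      by (force simp: set_pmf_iff)
    moreover have "a w x = 0"
      using True fin a0 by (cases "x \<in> X") (simp_all add: m_a sum_nonneg_eq_0_iff a_def)
    ultimately show ?thesis
      by simp
  next
    case False
    then have "w \<in> set_pmf (map_pmf snd q)"
      by (simp only: m_def set_pmf_iff not_False_eq_True)
    then have "pmf q ((x, y), w) * m w = a w x * b w y"
      using ci unfolding cond_indep_iff a_def b_def m_def by blast
    then show ?thesis
      using False by (simp add: u_def field_simps)
  qed
  have nonneg: "0 \<le> m w" "0 \<le> a w x" "0 \<le> b w y" for w x y
    by (simp_all add: m_def a_def b_def)
  show "factorization p X Y a u"
  proof (rule factorizationI)
    show "sum (u w) Y = 1" for w
      using y0 fin by (cases "m w = 0") (simp_all add: u_def m_b flip: sum_divide_distrib)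
    show "(\<lambda>w. a w x * u w y) sums pmf p (x, y)" for x y
      using pmf_map_fst_sums[of q "(x, y)"] by (simp add: prod p)
    show "u w y = 0" if "y \<notin> Y" for w y
      using y0 b0 that by (auto simp: u_def)
  qed (use nonneg a0 in \<open>auto simp: u_def\<close>)
  show "shannon_entropy (map_pmf snd q) = fact_entropy X a"
    by (rule shannon_entropy_nat) (simp only: m_a flip: m_def)
qed

text \<open>The products themselves serve as point masses of a joint law. Its symbols are those with
  nonzero mass, which later turns the vanishing of \<open>a\<close> into a bound on the
  alphabet.\<close>

lemma coupling_of_factorization:
  assumes fin: "finite X" "finite Y" and supp: "set_pmf p \<subseteq> X \<times> Y"
    and fact: "factorization p X Y a u"
  obtains q where "q \<in> markov_couplings p {w. sum (a w) X \<noteq> 0}"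
    and "shannon_entropy (map_pmf snd q) = fact_entropy X a"
proof
  note [simp] = factorizationD(1-5)[OF fact]
  define c where "c = (\<lambda>((x, y), w). a w x * u w y)"
  have c0: "0 \<le> c z" for z
    by (auto simp: c_def split: prod.split)
  have c_sums: "(\<lambda>w. c (z, w)) sums pmf p z" for z
    using factorizationD(6)[OF fact] by (cases z) (simp add: c_def)
  \<comment> \<open>Summing over \<open>w\<close> first gives \<open>p\<close>, which has total mass
    1.\<close>
  have "(\<integral>\<^sup>+ v. ennreal (c v) \<partial>count_space UNIV) =
      (\<integral>\<^sup>+ z. \<integral>\<^sup>+ w. ennreal (c (z, w)) \<partial>count_space UNIV \<partial>count_space UNIV)"
    by (rule nn_integral_fst_count_space[symmetric])
  also have "\<dots> = (\<integral>\<^sup>+ z. ennreal (pmf p z) \<partial>count_space UNIV)"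
    unfolding nn_integral_count_space_nat
    by (intro nn_integral_cong suminf_ennreal_eq c0 c_sums)
  also have "\<dots> = 1"
    by (simp add: nn_integral_pmf measure_pmf.emeasure_space_1[simplified])
  finally have total: "(\<integral>\<^sup>+ v. ennreal (c v) \<partial>count_space UNIV) = 1" .
  define q where "q = embed_pmf c"
  have pmf_q: "pmf q v = c v" for v
    unfolding q_def by (rule pmf_embed_pmf[OF c0 total])
  have "pmf (map_pmf fst q) z = pmf p z" for z
    using pmf_map_fst_sums[of q z] c_sums[of z] unfolding pmf_q by (rule sums_unique2)
  then have p: "map_pmf fst q = p"
    by (rule pmf_eqI)
  then have set_q: "set_pmf (map_pmf fst q) \<subseteq> X \<times> Y"
    using supp by simp
  have m: "pmf (map_pmf snd q) w = sum (a w) X" for w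
    unfolding pmf_snd_eq_sum[OF fin set_q] by (simp add: pmf_q c_def flip: sum_distrib_left)
  have XW: "pmf (map_pmf XW q) (x, w) = a w x" for x w
    unfolding pmf_XW_eq_sum[OF fin set_q] by (simp add: pmf_q c_def flip: sum_distrib_left)
  have YW: "pmf (map_pmf YW q) (y, w) = sum (a w) X * u w y" for y w
    unfolding pmf_YW_eq_sum[OF fin set_q] by (simp add: pmf_q c_def sum_distrib_right)
  \<comment> \<open>Both sides of the product form equal
    \<open>a w x * u w y * sum (a w) X\<close>.\<close>
  have "cond_indep q"
    unfolding cond_indep_iff m XW YW pmf_q by (simp add: c_def)
  moreover have "set_pmf (map_pmf snd q) = {w. sum (a w) X \<noteq> 0}"
    by (simp only: set_eq_iff set_pmf_iff m mem_Collect_eq simp_thms)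
  ultimately show "q \<in> markov_couplings p {w. sum (a w) X \<noteq> 0}"
    unfolding markov_couplings_def using p by simp
  show "shannon_entropy (map_pmf snd q) = fact_entropy X a"
    by (rule shannon_entropy_nat) (rule m)
qed

text \<open>Add the series for \<open>p\<close> over the finite set \<open>X \<times> Y\<close>.
  Inside each term the sum over \<open>Y\<close> contributes a factor 1 and leaves the mass of
  \<open>w\<close>.\<close>

lemma mass_sums:
  assumes fin: "finite X" "finite Y" and supp: "set_pmf p \<subseteq> X \<times> Y"
    and fact: "factorization p X Y a u"
  shows "(\<lambda>w. sum (a w) X) sums 1"
proof -
  have "(\<lambda>w. \<Sum>z\<in>X \<times> Y. a w (fst z) * u w (snd z)) sums (\<Sum>z\<in>X \<times> Y. pmf p z)"
    by (intro sums_sum) (use factorizationD(6)[OF fact] in auto)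
  moreover have "(\<Sum>z\<in>X \<times> Y. a w (fst z) * u w (snd z)) = sum (a w) X" for w
  proof -
    have "(\<Sum>z\<in>X \<times> Y. a w (fst z) * u w (snd z)) = (\<Sum>x\<in>X. \<Sum>y\<in>Y. a w x * u w y)"
      by (simp add: sum.cartesian_product split_def)
    then show ?thesis
      by (simp add: factorizationD(5)[OF fact] flip: sum_distrib_left)
  qed
  moreover have "(\<Sum>z\<in>X \<times> Y. pmf p z) = 1"
    using fin supp by (intro sum_pmf_eq_1) auto
  ultimately show ?thesis
    by simp
qed

lemma mass_le_1:
  assumes "finite X" "finite Y" "set_pmf p \<subseteq> X \<times> Y" "factorization p X Y a u"
  shows "sum (a w) X \<le> 1"
  using sum_le_suminf[OF sums_summable[OF mass_sums[OF assms]], of "{w}"]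
    sums_unique[OF mass_sums[OF assms]]
  by (auto intro: sum_nonneg factorizationD(1)[OF assms(4)])

section \<open>Merging symbols until all nonempty supports are distinct\<close>

abbreviation supp :: "('a \<Rightarrow> real) \<Rightarrow> 'a set" where
  "supp f \<equiv> {x. f x \<noteq> 0}"

text \<open>Let \<open>k\<close> be a heaviest symbol whose vector \<open>a k\<close> has support \<open>A\<close>. From every other such \<open>a w\<close>
  subtract the largest multiple \<open>t w * a k\<close> that keeps it nonnegative, which kills a coordinate;
  the rank-one terms \<open>a k x * (t w * u w y)\<close> removed in this way all share the factor \<open>a k\<close> and are
  absorbed by symbol \<open>k\<close>.\<close>

lemma merge_support:
  assumes fin: "finite X" "finite Y" and supp: "set_pmf p \<subseteq> X \<times> Y"
    and fact: "factorization p X Y a u"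
    and A: "A \<subseteq> X" "A \<noteq> {}"
  obtains a' u' where "factorization p X Y a' u'"
    and "fact_entropy X a' \<le> fact_entropy X a"
    and "\<And>w. supp (a' w) = supp (a w) \<or> supp (a' w) \<subset> A"
    and "\<And>v w. supp (a' v) = A \<Longrightarrow> supp (a' w) = A \<Longrightarrow> v = w"
proof (cases "\<exists>w. supp (a w) = A")
  case False
  then show ?thesis
    using that[of a u] fact by auto
next
  case True
  note a0 = factorizationD(1)[OF fact] and aX = factorizationD(2)[OF fact]
    and u0 = factorizationD(3)[OF fact] and uY = factorizationD(4)[OF fact]
    and u1 = factorizationD(5)[OF fact] and sums = factorizationD(6)[OF fact]
  define m where "m w = sum (a w) X" for w
  define C where "C = {w. supp (a w) = A}"
  have finA: "finite A"
    using fin A finite_subset by blast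
  have m0: "0 \<le> m w" for w
    unfolding m_def by (intro sum_nonneg a0)
  have aC: "0 < a w x \<longleftrightarrow> x \<in> A" if "w \<in> C" for w x
    using that a0[of w x] by (auto simp: C_def less_le)
  have mC: "0 < m w" if "w \<in> C" for w
  proof -
    obtain x where "x \<in> A"
      using A by auto
    then show ?thesis
      unfolding m_def using that A fin a0 aC by (intro sum_pos2[of X x]) auto
  qed
  have m_sums: "m sums 1"
    unfolding m_def[abs_def] by (rule mass_sums[OF fin supp fact])
  \<comment> \<open>\<open>C\<close> may be infinite, but masses tend to 0, so only finitely many
    symbols are at least as heavy as a given \<open>v\<close> in \<open>C\<close>; a heaviest one
    among these is heaviest in \<open>C\<close>.\<close>
  obtain k where k: "k \<in> C" and k_max: "\<And>w. w \<in> C \<Longrightarrow> m w \<le> m k"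
  proof -
    obtain v where v: "v \<in> C"
      using True by (auto simp: C_def)
    have "m \<longlonglongrightarrow> 0"
      using m_sums by (intro summable_LIMSEQ_zero) (rule sums_summable)
    then have "eventually (\<lambda>w. m w < m v) sequentially"
      using mC[OF v] by (rule order_tendstoD)
    then obtain n where n: "\<And>w. n \<le> w \<Longrightarrow> m w < m v"
      by (auto simp: eventually_sequentially)
    define D where "D = {w \<in> C. m v \<le> m w}"
    have "D \<subseteq> {..<n}"
      using n by (force simp: D_def not_le)
    then have D: "finite D" "v \<in> D"
      using v finite_subset by (auto simp: D_def)
    have "Max (m ` D) \<in> m ` D"
      using D by (intro Max_in) auto
    then obtain k where "k \<in> D" "Max (m ` D) = m k"
      by auto
    moreover from this D have "m w \<le> m k" if "w \<in> D" for w
      using that by (metis Max_ge finite_imageI imageI)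
    ultimately have kD: "k \<in> D" and k_max: "\<And>w. w \<in> D \<Longrightarrow> m w \<le> m k"
      by auto
    have "m w \<le> m k" if "w \<in> C" for w
      using that k_max[of w] kD by (cases "w \<in> D") (auto simp: D_def)
    then show ?thesis
      using that[of k] kD by (simp add: D_def)
  qed
  define t where "t w = (if w \<in> C \<and> w \<noteq> k then Min ((\<lambda>x. a w x / a k x) ` A) else 0)" for w
  have t_le: "t w * a k x \<le> a w x" for w x
  proof (cases "w \<in> C \<and> w \<noteq> k \<and> x \<in> A")
    case True
    then have "t w \<le> a w x / a k x"
      using finA by (simp add: t_def)
    moreover have "0 < a k x"
      using aC[OF k] True by simp
    ultimately show ?thesis
      by (simp add: field_simps)
  next
    case False
    then show ?thesis
      using a0[of w x] a0[of k x] aC[OF k, of x] by (auto simp: t_def)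
  qed
  have t_eq: "\<exists>x\<in>A. a w x = t w * a k x" if "w \<in> C" "w \<noteq> k" for w
  proof -
    have "t w \<in> (\<lambda>x. a w x / a k x) ` A"
      using that finA A by (simp add: t_def)
    then show ?thesis
      using aC[OF k] by force
  qed
  have t0: "0 \<le> t w" for w
    using finA A a0 by (simp add: t_def)
  have tk: "t k = 0"
    by (simp add: t_def)
  have t_m: "t w * m k \<le> m w" for w
    unfolding m_def sum_distrib_left by (intro sum_mono t_le)
  \<comment> \<open>This bound makes \<open>T\<close> finite even when infinitely many symbols are
    merged.\<close>
  have "t w \<le> m w / m k" for w
    using t_m mC[OF k] by (simp add: field_simps)
  moreover have "summable (\<lambda>w. m w / m k)"
    using sums_summable[OF m_sums] by (rule summable_divide)
  ultimately have t_summable: "summable t"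
    using t0 by (intro summable_comparison_test'[of "\<lambda>w. m w / m k" 0 t]) auto
  define T where "T = suminf t"
  have t_sums: "t sums T"
    unfolding T_def using t_summable by (rule summable_sums)
  have T0: "0 \<le> T"
    unfolding T_def using t_summable t0 by (rule suminf_nonneg)
  have u_le: "u w y \<le> 1" for w y
    using member_le_sum[of y Y "u w"] fin u0 u1[of w] uY[of y w] by (cases "y \<in> Y") auto
  \<comment> \<open>The removed terms for a fixed \<open>y\<close> add up to
    \<open>a k x * s y\<close>.\<close>
  define s where "s y = (\<Sum>w. t w * u w y)" for y
  have tu_summable: "summable (\<lambda>w. t w * u w y)" for y
    using mult_left_le[OF u_le t0] t0 u0
    by (intro summable_comparison_test'[OF t_summable, of 0]) simp
  then have s_sums: "(\<lambda>w. t w * u w y) sums s y" for y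
    unfolding s_def by (rule summable_sums)
  have s0: "0 \<le> s y" for y
    unfolding s_def using t0 u0 by (intro suminf_nonneg tu_summable) simp
  have sY: "s y = 0" if "y \<notin> Y" for y
    unfolding s_def by (simp add: uY[OF that])
  have s_T: "sum s Y = T"
  proof -
    have "(\<lambda>w. \<Sum>y\<in>Y. t w * u w y) sums sum s Y"
      by (intro sums_sum s_sums)
    then have "t sums sum s Y"
      by (simp add: u1 flip: sum_distrib_left)
    then show ?thesis
      using t_sums by (rule sums_unique2)
  qed
  \<comment> \<open>Symbol \<open>k\<close> must now carry \<open>a k x * (u k y + s y)\<close>. The
    vector \<open>u k + s\<close> has total \<open>1 + T\<close>, so this factor is moved from
    \<open>u'\<close> into \<open>a'\<close>.\<close>
  define a' where "a' w x = (if w = k then (1 + T) * a k x else a w x - t w * a k x)" for w x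
  define u' where "u' w y = (if w = k then (u k y + s y) / (1 + T) else u w y)" for w y
  have T1: "1 + T \<noteq> 0"
    using T0 by simp
  have fact': "factorization p X Y a' u'"
  proof (rule factorizationI)
    show "0 \<le> a' w x" for w x
      using a0 T0 t_le by (simp add: a'_def)
    show "a' w x = 0" if "x \<notin> X" for w x
      using aX[OF that] by (simp add: a'_def)
    show "0 \<le> u' w y" for w y
      using u0 s0 T0 by (simp add: u'_def)
    show "u' w y = 0" if "y \<notin> Y" for w y
      using uY[OF that] sY[OF that] by (simp add: u'_def)
    show "sum (u' w) Y = 1" for w
      using u1 s_T T1 by (cases "w = k") (simp_all add: u'_def sum.distrib flip: sum_divide_distrib)
    show "(\<lambda>w. a' w x * u' w y) sums pmf p (x, y)" for x y
    proof -
      \<comment> \<open>The removed terms are subtracted at their own indices and their total is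
        added at \<open>k\<close>, so the series keeps its sum.\<close>
      have "(\<lambda>w. a w x * u w y - a k x * (t w * u w y) + (if w = k then a k x * s y else 0))
          sums (pmf p (x, y) - a k x * s y + a k x * s y)"
        by (intro sums_add sums_diff sums_mult sums s_sums) (rule sums_single)
      moreover have "a w x * u w y - a k x * (t w * u w y) + (if w = k then a k x * s y else 0) =
          a' w x * u' w y" for w
      proof (cases "w = k")
        case True
        have "a' k x * u' k y = a k x * (u k y + s y)"
          using T1 by (simp add: a'_def u'_def)
        then show ?thesis
          using True by (simp add: tk distrib_left)
      next
        case False
        then show ?thesis
          by (simp add: a'_def u'_def algebra_simps)
      qed
      ultimately show ?thesis
        by simp
    qed
  qed
  have supp': "supp (a' w) = supp (a w)" if "w \<notin> C \<or> w = k" for w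
    using that T1 by (auto simp: a'_def t_def)
  have supp_less: "supp (a' w) \<subset> A" if "w \<in> C" "w \<noteq> k" for w
  proof -
    obtain x where "x \<in> A" "a w x = t w * a k x"
      using t_eq \<open>w \<in> C\<close> \<open>w \<noteq> k\<close> by blast
    moreover have "supp (a' w) \<subseteq> A"
    proof
      fix x
      assume "x \<in> supp (a' w)"
      then show "x \<in> A"
        using that aC[OF k, of x] aC[OF that(1), of x] a0[of k x] a0[of w x]
        by (auto simp: a'_def less_le)
    qed
    ultimately show ?thesis
      using that by (auto simp: a'_def)
  qed
  have A': "w = k" if "supp (a' w) = A" for w
  proof (rule ccontr)
    assume "w \<noteq> k"
    then show False
      using supp_less[of w] supp'[of w] that by (cases "w \<in> C") (auto simp: C_def)
  qed
  have entropy: "fact_entropy X a' \<le> fact_entropy X a"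
  proof (cases "fact_entropy X a = top")
    case False
    \<comment> \<open>The slope of \<open>plog\<close> at \<open>m k\<close>. By concavity, every unit of mass that leaves a lighter
      symbol saves at least \<open>K\<close>, and every unit that arrives at \<open>k\<close> costs at most \<open>K\<close>.\<close>
    define K where "K = - (ln (m k) + 1) / ln 2"
    define m' where "m' w = sum (a' w) X" for w
    have m'_eq: "m' w = (if w = k then m k + T * m k else m w - t w * m k)" for w
    proof (cases "w = k")
      case True
      have "m' k = (1 + T) * m k"
        by (simp add: m'_def m_def a'_def flip: sum_distrib_left)
      then show ?thesis
        using True by (simp add: distrib_right)
    next
      case False
      then show ?thesis
        by (simp add: m'_def m_def a'_def sum_subtractf flip: sum_distrib_left)
    qed
    \<comment> \<open>\<open>h\<close> bounds the new entropy term by term. Its corrections cancel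
      in the sum: mass \<open>T * m k\<close> leaves the other symbols and arrives at
      \<open>k\<close>, both priced at \<open>K\<close>.\<close>
    define h where "h w = plog (m w) - t w * (m k * K) + (if w = k then T * (m k * K) else 0)" for w
    have m_le: "m w \<le> 1" for w
      unfolding m_def by (rule mass_le_1[OF fin supp fact])
    have m'_le: "0 \<le> m' w" "m' w \<le> 1" for w
      unfolding m'_def using factorizationD(1)[OF fact'] mass_le_1[OF fin supp fact']
      by (auto intro: sum_nonneg)
    have "summable (\<lambda>w. plog (m w))"
      using False unfolding fact_entropy_def m_def[symmetric]
      by (intro summable_suminf_not_top plog_nonneg m0 m_le)
    then have h_sums: "h sums ((\<Sum>w. plog (m w)) - T * (m k * K) + T * (m k * K))"
      unfolding h_def[abs_def]
      by (intro sums_add sums_diff sums_mult2 summable_sums t_sums)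
        (assumption, rule sums_single)
    have le: "plog (m' w) \<le> h w" for w
    proof -
      consider "w = k" | "w \<noteq> k" "w \<in> C" | "w \<noteq> k" "w \<notin> C"
        by auto
      then show ?thesis
      proof cases
        case 1
        have "plog (m k + T * m k) \<le> plog (m k) + (m k + T * m k - m k) * (- (ln (m k) + 1) / ln 2)"
          using mC[OF k] T0 by (intro plog_tangent) auto
        then show ?thesis
          using 1 by (simp add: m'_eq h_def K_def tk mult.assoc)
      next
        case 2
        have "plog (m w - t w * m k) \<le> plog (m w) - t w * m k * (- (ln (m k) + 1) / ln 2)"
          using t0 m0 t_m mC k_max 2 by (intro plog_move_mass) auto
        then show ?thesis
          using 2 by (simp add: m'_eq h_def K_def mult.assoc)
      next
        case 3
        then show ?thesis
          by (simp add: m'_eq h_def t_def)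
      qed
    qed
    have "fact_entropy X a' \<le> (\<Sum>w. ennreal (h w))"
      unfolding fact_entropy_def m'_def[symmetric] by (intro suminf_le ennreal_leI le) auto
    \<comment> \<open>The terms \<open>h w\<close> are nonnegative because they dominate
      \<open>plog (m' w)\<close>, so the real sum carries over to \<open>ennreal\<close>.\<close>
    also have "\<dots> = ennreal (\<Sum>w. plog (m w))"
      using h_sums le plog_nonneg[OF m'_le] by (intro suminf_ennreal_eq) (auto intro: order_trans)
    also have "\<dots> = fact_entropy X a"
      using False unfolding fact_entropy_def m_def[symmetric]
      by (intro suminf_ennreal[symmetric] plog_nonneg m0 m_le)
    finally show ?thesis .
  qed simp
  show ?thesis
  proof (rule that[OF fact' entropy])
    show "supp (a' w) = supp (a w) \<or> supp (a' w) \<subset> A" for w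
      using supp'[of w] supp_less[of w] by blast
    show "v = w" if "supp (a' v) = A" "supp (a' w) = A" for v w
      using A' that by metis
  qed
qed

text \<open>Treat the supports from large to small. Merging at \<open>A\<close> creates only
  supports strictly below \<open>A\<close>, so it cannot spoil supports that have already been
  cleared.\<close>

lemma distinct_supports:
  assumes fin: "finite X" "finite Y" and supp: "set_pmf p \<subseteq> X \<times> Y"
    and fact: "factorization p X Y a u"
  obtains a' u' where "factorization p X Y a' u'"
    and "fact_entropy X a' \<le> fact_entropy X a"
    and "inj_on (\<lambda>w. supp (a' w)) {w. supp (a' w) \<noteq> {}}"
proof -
  define S where "S = Pow X - {{}}"
  have finS: "finite S"
    using fin by (simp add: S_def)
  \<comment> \<open>\<open>F\<close> is the upward closed family of cleared supports; the induction
    is on the number of supports still to be cleared.\<close>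
  have "\<exists>a' u'. factorization p X Y a' u' \<and> fact_entropy X a' \<le> fact_entropy X a \<and>
      (\<forall>v w. supp (a' v) \<in> S \<longrightarrow> supp (a' w) = supp (a' v) \<longrightarrow> v = w)"
    if "F \<subseteq> S" and "\<And>A B. A \<in> F \<Longrightarrow> B \<in> S \<Longrightarrow> A \<subseteq> B \<Longrightarrow> B \<in> F"
      and "factorization p X Y a u"
      and "\<And>v w. supp (a v) \<in> F \<Longrightarrow> supp (a w) = supp (a v) \<Longrightarrow> v = w" for F a u
    using that
  proof (induction "card (S - F)" arbitrary: F a u rule: less_induct)
    case less
    note F = less.prems(1) and up = less.prems(2) and fact = less.prems(3) and uniq = less.prems(4)
    show ?case
    proof (cases "F = S")
      case True
      have "v = w" if "supp (a v) \<in> S" "supp (a w) = supp (a v)" for v w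
        using uniq[of v w] that True by blast
      then show ?thesis
        using fact by blast
    next
      case False
      then have "S - F \<noteq> {}" "finite (S - F)"
        using F finS by auto
      then obtain A where A: "A \<in> S - F" and A_max: "\<And>B. B \<in> S - F \<Longrightarrow> A \<subseteq> B \<Longrightarrow> A = B"
        using finite_has_maximal by meson
      then have AX: "A \<subseteq> X" "A \<noteq> {}"
        by (auto simp: S_def)
      obtain a2 u2 where fact2: "factorization p X Y a2 u2"
        and ent2: "fact_entropy X a2 \<le> fact_entropy X a"
        and supp2: "\<And>w. supp (a2 w) = supp (a w) \<or> supp (a2 w) \<subset> A"
        and uniq2: "\<And>v w. supp (a2 v) = A \<Longrightarrow> supp (a2 w) = A \<Longrightarrow> v = w"
        using merge_support[OF fin supp fact AX] by metis
      \<comment> \<open>A new support lies strictly below \<open>A\<close>. Were it in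
        \<open>F\<close>, upward closure would put \<open>A\<close> in \<open>F\<close> as
        well.\<close>
      have keep: "supp (a w) = supp (a2 w)" if "supp (a2 w) \<in> F" for w
        using supp2[of w] up[of "supp (a2 w)" A] that A by auto
      have uniq3: "v = w" if "supp (a2 v) \<in> insert A F" "supp (a2 w) = supp (a2 v)" for v w
      proof (cases "supp (a2 v) = A")
        case True
        then show ?thesis
          using uniq2 that by simp
      next
        case False
        then have F2: "supp (a2 v) \<in> F" "supp (a2 w) \<in> F"
          using that by simp_all
        show ?thesis
          using F2 that(2) by (intro uniq) (simp_all only: keep)
      qed
      \<comment> \<open>By maximality of \<open>A\<close>, every proper superset of \<open>A\<close>
        in \<open>S\<close> is already in \<open>F\<close>.\<close>
      have up3: "C \<in> insert A F" if "B \<in> insert A F" "C \<in> S" "B \<subseteq> C" for B C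
      proof (cases "B = A")
        case True
        then show ?thesis
          using A_max that(2,3) by blast
      next
        case False
        then show ?thesis
          using up that by blast
      qed
      have "S - insert A F \<subset> S - F"
        using A by blast
      then have "card (S - insert A F) < card (S - F)"
        using finS by (intro psubset_card_mono) auto
      moreover have "insert A F \<subseteq> S"
        using A F by simp
      ultimately have "\<exists>a' u'. factorization p X Y a' u' \<and> fact_entropy X a' \<le> fact_entropy X a2 \<and>
          (\<forall>v w. supp (a' v) \<in> S \<longrightarrow> supp (a' w) = supp (a' v) \<longrightarrow> v = w)"
        by (rule less.hyps[OF _ _ up3 fact2 uniq3])
      then show ?thesis
        using ent2 by (meson order_trans)
    qed
  qed
  from this[of "{}" a u] obtain a' u' where fact': "factorization p X Y a' u'"
    and ent: "fact_entropy X a' \<le> fact_entropy X a"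
    and uniq: "\<And>v w. supp (a' v) \<in> S \<Longrightarrow> supp (a' w) = supp (a' v) \<Longrightarrow> v = w"
    using fact by blast
  have "supp (a' w) \<subseteq> X" for w
    using factorizationD(2)[OF fact'] by auto
  then have "inj_on (\<lambda>w. supp (a' w)) {w. supp (a' w) \<noteq> {}}"
    using uniq by (intro inj_onI) (simp add: S_def)
  then show ?thesis
    using that fact' ent by blast
qed

section \<open>The bound on the alphabet\<close>

lemma relabel_factorization:
  assumes fact: "factorization p X Y a u"
    and W: "finite W" "card W \<le> N" and zero: "\<And>w x. w \<notin> W \<Longrightarrow> a w x = 0"
  obtains a' u' where "factorization p X Y a' u'"
    and "fact_entropy X a' = fact_entropy X a"
    and "\<And>w x. N \<le> w \<Longrightarrow> a' w x = 0"
proof -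
  obtain h where h: "bij_betw h {0..<card W} W"
    using ex_bij_betw_nat_finite W by blast
  define a' where "a' v = (if v < card W then a (h v) else (\<lambda>_. 0))" for v
  \<comment> \<open>Beyond \<open>card W\<close> any probability vector will do; \<open>u 0\<close>
    is at hand.\<close>
  define u' where "u' v = (if v < card W then u (h v) else u 0)" for v
  have "factorization p X Y a' u'"
  proof (rule factorizationI)
    show "(\<lambda>w. a' w x * u' w y) sums pmf p (x, y)" for x y
    proof -
      have "(\<lambda>v. a' v x * u' v y) sums (\<Sum>v = 0..<card W. a' v x * u' v y)"
        by (rule sums_finite) (auto simp: a'_def)
      also have "(\<Sum>v = 0..<card W. a' v x * u' v y) = (\<Sum>v = 0..<card W. a (h v) x * u (h v) y)"
        by (intro sum.cong) (auto simp: a'_def u'_def)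
      also have "\<dots> = (\<Sum>w\<in>W. a w x * u w y)"
        by (rule sum.reindex_bij_betw[OF h])
      also have "\<dots> = pmf p (x, y)"
        using W zero by (intro sums_unique2[OF sums_finite factorizationD(6)[OF fact]]) auto
      finally show ?thesis .
    qed
  qed (use factorizationD[OF fact] in \<open>auto simp: a'_def u'_def\<close>)
  moreover have "fact_entropy X a' = fact_entropy X a"
  proof -
    have "fact_entropy X a' = (\<Sum>v = 0..<card W. ennreal (plog (sum (a' v) X)))"
      unfolding fact_entropy_def by (rule suminf_finite) (auto simp: a'_def plog_def)
    also have "\<dots> = (\<Sum>v = 0..<card W. ennreal (plog (sum (a (h v)) X)))"
      by (intro sum.cong) (auto simp: a'_def)
    also have "\<dots> = (\<Sum>w\<in>W. ennreal (plog (sum (a w) X)))"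
      by (rule sum.reindex_bij_betw[OF h])
    also have "\<dots> = fact_entropy X a"
      unfolding fact_entropy_def
      using W zero by (intro suminf_finite[symmetric]) (auto simp: plog_def)
    finally show ?thesis .
  qed
  moreover have "a' w x = 0" if "N \<le> w" for w x
    using that W by (simp add: a'_def)
  ultimately show ?thesis
    by (rule that)
qed

text \<open>The symbols with mass inject, by their supports, into the \<open>2 ^ card X - 1\<close>
  nonempty subsets of \<open>X\<close>, and are then renumbered from 0.\<close>

lemma reduce_alphabet:
  assumes fin: "finite X" "finite Y" and supp: "set_pmf p \<subseteq> X \<times> Y"
    and fact: "factorization p X Y a u"
  obtains a' u' where "factorization p X Y a' u'"
    and "fact_entropy X a' \<le> fact_entropy X a"
    and "\<And>w x. 2 ^ card X - 1 \<le> w \<Longrightarrow> a' w x = 0"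
proof -
  obtain a1 u1 where fact1: "factorization p X Y a1 u1"
    and ent1: "fact_entropy X a1 \<le> fact_entropy X a"
    and inj: "inj_on (\<lambda>w. supp (a1 w)) {w. supp (a1 w) \<noteq> {}}"
    using distinct_supports[OF assms] by blast
  define W where "W = {w. supp (a1 w) \<noteq> {}}"
  have sub: "(\<lambda>w. supp (a1 w)) ` W \<subseteq> Pow X - {{}}"
    using factorizationD(2)[OF fact1] by (auto simp: W_def)
  have "finite W"
    using inj sub fin unfolding W_def[symmetric] by (meson finite_Diff finite_Pow_iff inj_on_finite)
  moreover have "card W \<le> 2 ^ card X - 1"
    using card_inj_on_le[OF inj[folded W_def] sub] fin by (simp add: card_Diff_subset card_Pow)
  moreover have "a1 w x = 0" if "w \<notin> W" for w x
    using that by (auto simp: W_def)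
  ultimately obtain a' u' where "factorization p X Y a' u'"
    "fact_entropy X a' = fact_entropy X a1" "\<And>w x. 2 ^ card X - 1 \<le> w \<Longrightarrow> a' w x = 0"
    using relabel_factorization[OF fact1] by blast
  then show ?thesis
    using that ent1 by metis
qed

section \<open>A minimal factorization by compactness\<close>

lemma compact_fun_Collect:
  fixes S :: "'i \<Rightarrow> 'c::topological_space set"
  assumes "\<And>i. compact (S i)"
  shows "compact {f. \<forall>i. f i \<in> S i}"
proof -
  \<comment> \<open>This is Tychonoff's theorem; function types carry the product topology.\<close>
  have "compactin (product_topology (\<lambda>i. euclidean) UNIV) (PiE UNIV S)"
    using assms by (simp add: compactin_PiE)
  moreover have "PiE UNIV S = {f. \<forall>i. f i \<in> S i}"
    by (auto simp: PiE_def Pi_def)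
  ultimately show ?thesis
    by (simp add: euclidean_product_topology)
qed

lemma continuous_on_coord2:
  assumes "continuous_on S f"
  shows "continuous_on S (\<lambda>z. f z i j)"
  by (rule continuous_on_product_then_coordinatewise
      [OF continuous_on_product_then_coordinatewise[OF assms]])

text \<open>The factorizations supported below \<open>N\<close> form a compact set, on which the
  entropy is a finite sum of continuous terms and so attains its minimum.\<close>

lemma minimal_factorization:
  fixes p :: "('a \<times> 'b) pmf"
  assumes fin: "finite X" "finite Y" and supp: "set_pmf p \<subseteq> X \<times> Y"
    and ex: "factorization p X Y a0 u0" "\<And>w x. N \<le> w \<Longrightarrow> a0 w x = 0"
  obtains a u where "factorization p X Y a u" and "\<And>w x. N \<le> w \<Longrightarrow> a w x = 0"
    and "\<And>a' u'. factorization p X Y a' u' \<Longrightarrow> (\<And>w x. N \<le> w \<Longrightarrow> a' w x = 0) \<Longrightarrow>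
      fact_entropy X a \<le> fact_entropy X a'"
proof -
  \<comment> \<open>The upper bounds 1 exclude nothing: masses and probabilities are at most
    1.\<close>
  let ?SA = "\<lambda>w x. if w < N \<and> x \<in> X then {0..1::real} else {0}"
  let ?SU = "\<lambda>y. if y \<in> Y then {0..1::real} else {0}"
  define B where "B = {a. \<forall>w. a w \<in> {f. \<forall>x. f x \<in> ?SA w x}} \<times>
    {u. \<forall>w::nat. u w \<in> {f. \<forall>y. f y \<in> ?SU y}}"
  \<comment> \<open>With \<open>a\<close> zero from \<open>N\<close> on, the series become finite
    sums, so every constraint is an equation between continuous functions.\<close>
  define E where "E = {z :: (nat \<Rightarrow> 'a \<Rightarrow> real) \<times> (nat \<Rightarrow> 'b \<Rightarrow> real).
    (\<forall>w. sum (snd z w) Y = 1) \<and> (\<forall>x y. (\<Sum>w<N. fst z w x * snd z w y) = pmf p (x, y))}"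
  have "compact B"
    unfolding B_def by (intro compact_Times compact_fun_Collect) auto
  moreover have cont_fst: "continuous_on T (\<lambda>z. fst z w x)"
    for T :: "((nat \<Rightarrow> 'a \<Rightarrow> real) \<times> (nat \<Rightarrow> 'b \<Rightarrow> real)) set" and w x
    by (rule continuous_on_coord2) (intro continuous_intros)
  moreover have cont_snd: "continuous_on T (\<lambda>z. snd z w x)"
    for T :: "((nat \<Rightarrow> 'a \<Rightarrow> real) \<times> (nat \<Rightarrow> 'b \<Rightarrow> real)) set" and w x
    by (rule continuous_on_coord2) (intro continuous_intros)
  moreover have "closed E"
    unfolding E_def
    by (intro closed_Collect_conj closed_Collect_all closed_Collect_eq
        continuous_on_sum continuous_on_mult cont_fst cont_snd continuous_on_const)
  ultimately have comp: "compact (B \<inter> E)"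
    by (simp add: compact_Int_closed)
  have iff: "(a, u) \<in> B \<inter> E \<longleftrightarrow> factorization p X Y a u \<and> (\<forall>w x. N \<le> w \<longrightarrow> a w x = 0)" for a u
  proof
    assume "(a, u) \<in> B \<inter> E"
    then have a: "\<And>w x. a w x \<in> ?SA w x" and u: "\<And>w y. u w y \<in> ?SU y"
      and u1: "\<And>w. sum (u w) Y = 1"
      and p: "\<And>x y. (\<Sum>w<N. a w x * u w y) = pmf p (x, y)"
      by (auto simp: B_def E_def)
    have a_zero: "a w x = 0" if "N \<le> w \<or> x \<notin> X" for w x
      using a[of w x] that by auto
    have "(\<lambda>w. a w x * u w y) sums pmf p (x, y)" for x y
      unfolding p[symmetric] by (rule sums_finite) (auto simp: a_zero)
    moreover have "0 \<le> a w x" "0 \<le> u w y" for w x y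
      using a[of w x] u[of w y] by (auto split: if_splits)
    moreover have "u w y = 0" if "y \<notin> Y" for w y
      using u[of w y] that by auto
    ultimately show "factorization p X Y a u \<and> (\<forall>w x. N \<le> w \<longrightarrow> a w x = 0)"
      using u1 a_zero by (auto intro!: factorizationI)
  next
    assume "factorization p X Y a u \<and> (\<forall>w x. N \<le> w \<longrightarrow> a w x = 0)"
    then have fact: "factorization p X Y a u" and zero: "\<And>w x. N \<le> w \<Longrightarrow> a w x = 0"
      by auto
    note f = factorizationD[OF fact]
    have "a w x \<le> 1" if "x \<in> X" for w x
      using member_le_sum[of x X "a w"] that f(1) fin mass_le_1[OF fin supp fact, of w] by auto
    moreover have "u w y \<le> 1" if "y \<in> Y" for w y
      using member_le_sum[of y Y "u w"] that f(3) fin f(5)[of w] by auto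
    ultimately have "(a, u) \<in> B"
      using f(1-4) zero by (auto simp: B_def)
    moreover have "(\<Sum>w<N. a w x * u w y) = pmf p (x, y)" for x y
      using zero by (intro sums_unique2[OF sums_finite f(6)]) auto
    ultimately show "(a, u) \<in> B \<inter> E"
      using f(5) by (simp add: E_def)
  qed
  define H where "H z = (\<Sum>w<N. plog (sum (fst z w) X))"
    for z :: "(nat \<Rightarrow> 'a \<Rightarrow> real) \<times> (nat \<Rightarrow> 'b \<Rightarrow> real)"
  have entropy: "fact_entropy X a = ennreal (H (a, u))" if "(a, u) \<in> B \<inter> E" for a u
  proof -
    have fact: "factorization p X Y a u" and zero: "\<And>w x. N \<le> w \<Longrightarrow> a w x = 0"
      using that unfolding iff by auto
    have "fact_entropy X a = (\<Sum>w<N. ennreal (plog (sum (a w) X)))"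
      unfolding fact_entropy_def using zero by (intro suminf_finite) (auto simp: plog_def)
    also have "\<dots> = ennreal (H (a, u))"
      unfolding H_def fst_conv
      by (intro sum_ennreal plog_nonneg sum_nonneg factorizationD(1)[OF fact]
          mass_le_1[OF fin supp fact])
    finally show ?thesis .
  qed
  have "continuous_on (B \<inter> E) H"
    unfolding H_def
  proof (intro continuous_on_sum continuous_on_compose2[OF continuous_on_plog])
    show "(\<lambda>z. sum (fst z w) X) ` (B \<inter> E) \<subseteq> {0..}" for w
    proof (rule image_subsetI)
      fix z
      assume "z \<in> B \<inter> E"
      then have "factorization p X Y (fst z) (snd z)"
        using iff[of "fst z" "snd z"] by simp
      then show "sum (fst z w) X \<in> {0..}"
        by (simp add: sum_nonneg factorizationD(1))
    qed
  qed (rule cont_fst)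
  moreover have "B \<inter> E \<noteq> {}"
    using iff ex by blast
  ultimately obtain z where z: "z \<in> B \<inter> E" "\<And>z'. z' \<in> B \<inter> E \<Longrightarrow> H z \<le> H z'"
    using continuous_attains_inf[OF comp] by blast
  obtain a u where au: "z = (a, u)"
    by (cases z)
  show ?thesis
  proof (rule that[of a u])
    show "factorization p X Y a u" and "\<And>w x. N \<le> w \<Longrightarrow> a w x = 0"
      using z(1) iff unfolding au by auto
    fix a' u'
    assume "factorization p X Y a' u'" "\<And>w x. N \<le> w \<Longrightarrow> a' w x = 0"
    then have "(a', u') \<in> B \<inter> E"
      using iff by blast
    then show "fact_entropy X a \<le> fact_entropy X a'"
      using z entropy unfolding au by (metis ennreal_leI)
  qed
qed

section \<open>Existence of a minimal coupling\<close>

lemma pmf_map_graph: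
  "pmf (map_pmf (\<lambda>z. (f z, z)) p) (x, w) = (if x = f w then pmf p w else 0)"
proof (cases "x = f w")
  case True
  have "inj (\<lambda>z. (f z, z))"
    by (rule injI) simp
  from pmf_map_inj'[OF this, of p w] show ?thesis
    using True by simp
next
  case False
  then show ?thesis
    by (auto simp: pmf_eq_0_set_pmf)
qed

text \<open>Take W = (X, Y): given W both variables are constant, hence independent. Then relabel W
  by natural numbers.\<close>

lemma markov_couplings_nonempty:
  fixes p :: "('a \<times> 'b) pmf"
  obtains q where "q \<in> markov_couplings p (UNIV :: nat set)"
proof -
  let ?q = "map_pmf (\<lambda>z. (z, z)) p"
  have "pmf ?q (z, w) = (if z = w then pmf p w else 0)" for z w
    by (rule pmf_map_graph)
  moreover have "pmf (map_pmf XW ?q) (x, w) = (if x = fst w then pmf p w else 0)" for x w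
    using pmf_map_graph[of fst p x w] by (simp add: pmf.map_comp comp_def)
  moreover have "pmf (map_pmf YW ?q) (y, w) = (if y = snd w then pmf p w else 0)" for y w
    using pmf_map_graph[of snd p y w] by (simp add: pmf.map_comp comp_def)
  moreover have "map_pmf snd ?q = p" "map_pmf fst ?q = p"
    by (simp_all add: pmf.map_comp comp_def)
  ultimately have "?q \<in> markov_couplings p UNIV"
    by (auto simp: markov_couplings_def cond_indep_iff)
  then show ?thesis
    using markov_couplings_relabel that by metis
qed

text \<open>Every coupling is matched or beaten by a factorization on the bounded alphabet, so a
  minimizer among these is minimal among all couplings.\<close>

lemma minimal_coupling:
  fixes p :: "('a \<times> 'b) pmf"
  assumes fin: "finite X" "finite Y" and supp: "set_pmf p \<subseteq> X \<times> Y"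
  obtains q where "q \<in> markov_couplings p {..<2 ^ card X - 1 :: nat}"
    and "\<And>q'. q' \<in> markov_couplings p (UNIV :: nat set) \<Longrightarrow>
      shannon_entropy (map_pmf snd q) \<le> shannon_entropy (map_pmf snd q')"
proof -
  let ?N = "2 ^ card X - 1 :: nat"
  have reduce: "\<exists>a u. factorization p X Y a u \<and> (\<forall>w x. ?N \<le> w \<longrightarrow> a w x = 0) \<and>
      fact_entropy X a \<le> shannon_entropy (map_pmf snd q)"
    if q: "q \<in> markov_couplings p (UNIV :: nat set)" for q
  proof -
    obtain a u where au: "factorization p X Y a u"
      "shannon_entropy (map_pmf snd q) = fact_entropy X a"
      using factorization_of_coupling[OF assms q] .
    obtain a' u' where "factorization p X Y a' u'" "fact_entropy X a' \<le> fact_entropy X a"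
      "\<And>w x. ?N \<le> w \<Longrightarrow> a' w x = 0"
      using reduce_alphabet[OF assms au(1)] by blast
    then show ?thesis
      using au(2) by auto
  qed
  \<comment> \<open>Reducing the coupling with W = (X, Y) shows that the compact set is
    nonempty.\<close>
  obtain a0 u0 where "factorization p X Y a0 u0" "\<And>w x. ?N \<le> w \<Longrightarrow> a0 w x = 0"
    using reduce markov_couplings_nonempty by metis
  then obtain a u where fact: "factorization p X Y a u" and zero: "\<And>w x. ?N \<le> w \<Longrightarrow> a w x = 0"
    and least: "\<And>a' u'. factorization p X Y a' u' \<Longrightarrow> (\<And>w x. ?N \<le> w \<Longrightarrow> a' w x = 0) \<Longrightarrow>
      fact_entropy X a \<le> fact_entropy X a'"
    using minimal_factorization[OF assms, of a0 u0 ?N] by blast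
  obtain q where q: "q \<in> markov_couplings p {w. sum (a w) X \<noteq> 0}"
    and ent: "shannon_entropy (map_pmf snd q) = fact_entropy X a"
    using coupling_of_factorization[OF assms fact] .
  have "{w. sum (a w) X \<noteq> 0} \<subseteq> {..<?N}"
    using zero by (auto simp: not_le[symmetric])
  then have "q \<in> markov_couplings p {..<?N}"
    using q unfolding markov_couplings_def by blast
  moreover have "shannon_entropy (map_pmf snd q) \<le> shannon_entropy (map_pmf snd q')"
    if "q' \<in> markov_couplings p (UNIV :: nat set)" for q'
    using reduce[OF that] least unfolding ent by (meson order_trans)
  ultimately show ?thesis
    by (rule that)
qed

section \<open>Exchanging the two variables\<close>

lemma markov_couplings_swap:
  assumes "q \<in> markov_couplings p \<W>"
  shows "map_pmf (map_prod prod.swap id) q \<in> markov_couplings (map_pmf prod.swap p) \<W>"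
proof -
  let ?q = "map_pmf (map_prod prod.swap id) q"
  have p: "map_pmf fst q = p"
    using assms by (simp add: markov_couplings_def)
  have "inj (map_prod prod.swap id)"
    by (simp add: prod.inj_map)
  then have "pmf ?q ((y, x), w) = pmf q ((x, y), w)" for x y w
    using pmf_map_inj'[of "map_prod prod.swap id" q "((x, y), w)"] by simp
  moreover have "map_pmf snd ?q = map_pmf snd q" "map_pmf XW ?q = map_pmf YW q"
    "map_pmf YW ?q = map_pmf XW q" "map_pmf fst ?q = map_pmf prod.swap p"
    by (simp_all add: pmf.map_comp comp_def flip: p)
  ultimately show ?thesis
    using assms by (simp add: markov_couplings_def cond_indep_iff mult.commute del: set_map_pmf)
qed

text \<open>If \<open>Y\<close> is the smaller alphabet, minimize for the swapped law and swap back;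
  neither swap changes the law of W.\<close>

lemma minimal_coupling_min_card:
  fixes p :: "('a \<times> 'b) pmf"
  assumes fin: "finite X" "finite Y" and supp: "set_pmf p \<subseteq> X \<times> Y"
  obtains q where "q \<in> markov_couplings p {..<2 ^ min (card X) (card Y) - 1 :: nat}"
    and "\<And>q'. q' \<in> markov_couplings p (UNIV :: nat set) \<Longrightarrow>
      shannon_entropy (map_pmf snd q) \<le> shannon_entropy (map_pmf snd q')"
proof (cases "card X \<le> card Y")
  case True
  then show ?thesis
    using minimal_coupling[OF assms] that by (metis min.absorb1)
next
  case False
  then have N: "min (card X) (card Y) = card Y"
    by simp
  let ?s = "map_pmf (map_prod prod.swap id)"
  have "set_pmf (map_pmf prod.swap p) \<subseteq> Y \<times> X"
    using supp by auto
  then obtain q where q: "q \<in> markov_couplings (map_pmf prod.swap p) {..<2 ^ card Y - 1 :: nat}"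
    and least: "\<And>q'. q' \<in> markov_couplings (map_pmf prod.swap p) (UNIV :: nat set) \<Longrightarrow>
      shannon_entropy (map_pmf snd q) \<le> shannon_entropy (map_pmf snd q')"
    using minimal_coupling[OF fin(2,1)] by metis
  have snd_swap: "map_pmf snd (?s r) = map_pmf snd r" for r :: "(('c \<times> 'd) \<times> nat) pmf"
    by (simp add: pmf.map_comp comp_def)
  show ?thesis
  proof (rule that[of "?s q"])
    show "?s q \<in> markov_couplings p {..<2 ^ min (card X) (card Y) - 1 :: nat}"
      using markov_couplings_swap[OF q] by (simp add: N pmf.map_comp comp_def)
    show "shannon_entropy (map_pmf snd (?s q)) \<le> shannon_entropy (map_pmf snd q')"
      if "q' \<in> markov_couplings p (UNIV :: nat set)" for q'
      using least[OF markov_couplings_swap[OF that]] unfolding snd_swap .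
  qed
qed

theorem proposition6:
  fixes p :: "('a \<times> 'b) pmf" and \<X> :: "'a set" and \<Y> :: "'b set"
  assumes "finite \<X>" and "finite \<Y>" and "set_pmf p \<subseteq> \<X> \<times> \<Y>"
  defines "N \<equiv> 2 ^ min (card \<X>) (card \<Y>) - 1"
  shows "common_entropy p \<in> markov_entropies p \<and>
    Inf (markov_entropies_card p N) \<in> markov_entropies_card p N \<and>
    common_entropy p = Inf (markov_entropies_card p N)"
proof -
  obtain q where q: "q \<in> markov_couplings p {..<N}"
    and least: "\<And>q'. q' \<in> markov_couplings p (UNIV :: nat set) \<Longrightarrow>
      shannon_entropy (map_pmf snd q) \<le> shannon_entropy (map_pmf snd q')"
    using minimal_coupling_min_card[OF assms(1-3)] unfolding N_def by metis
  \<comment> \<open>This one value lies in both sets of entropies and is a lower bound of both,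
    since a coupling on a restricted alphabet is in particular a coupling.\<close>
  let ?h = "shannon_entropy (map_pmf snd q)"
  have UNIV: "q' \<in> markov_couplings p UNIV" if "q' \<in> markov_couplings p \<W>" for q' \<W>
    using that by (simp add: markov_couplings_def)
  have mem: "?h \<in> markov_entropies p"
    using UNIV[OF q] unfolding markov_entropies_def by blast
  have mem_card: "?h \<in> markov_entropies_card p N"
    unfolding markov_entropies_card_def using q by (auto intro!: exI[of _ q] exI[of _ "{..<N}"])
  have "Inf (markov_entropies p) = ?h"
    using mem least by (intro cInf_eq_minimum) (auto simp: markov_entropies_def)
  moreover have "Inf (markov_entropies_card p N) = ?h"
    using mem_card least UNIV by (intro cInf_eq_minimum) (auto simp: markov_entropies_card_def)
  ultimately show ?thesis
    using mem mem_card by (simp add: common_entropy_def)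
qed

end
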